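(* Let $m \geq 2$ be an integer, then $$ \mathsf{D}^{(3)} (\{-m,\dots,m\}^2) = 4m^2 -q(m). $$ Moreover, up to symmetries, there is only one minimal zero-sum sequence over $\{-m,\dots,m\}^2$ having a support of size $3$ and maximum length, namely $\begin{pmatrix} m \\ m \end{pmatrix}$ repeated $q(m)(m -1) + m$ times, $\begin{pmatrix} -m \\ m-1 \end{pmatrix}$ repeated $2m^2 - mq(m)$ times, and $\begin{pmatrix} m-q(m) \\ -m \end{pmatrix}$ repeated $2m^2-m$ times.
   Context: For a subset $X$ of an abelian group, a sequence is an unordered multiset of elements of $X$; it is a minimal zero-sum sequence if its elements sum to $0$ and no non-empty proper subsequence sums to $0$. $\mathsf{D}^{(k)}(X)$ denotes the maximal length of a minimal zero-sum sequence over $X$ whose support (set of distinct elements) has size exactly $k$. $\{-m,\dots,m\}$ denotes the set of integers $i$ with $-m\le i\le m$. For an integer $m\ge 2$, $q(m)$ denotes the smallest prime not dividing $m$. Symmetries are those of the square, generated by $(x,y)\mapsto(-x,y)$ and $(x,y)\mapsto(y,x)$. *)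

theory Defs
  imports
    "HOL-Library.Multiset"
    "HOL-Library.Extended_Nat"
    "HOL-Library.Product_Plus"
    "HOL-Computational_Algebra.Primes"
begin

text \<open>
  Sequences over a subset of an abelian group are finite multisets; a subsequence is a submultiset.
  The empty sequence counts as a minimal zero-sum sequence here; it has support of size 0.
\<close>

definition minimal_zero_sum :: "'a::ab_group_add multiset \<Rightarrow> bool" where
  "minimal_zero_sum S \<longleftrightarrow>
     \<Sum>\<^sub># S = 0 \<and> (\<forall>T. T \<subset># S \<longrightarrow> T \<noteq> {#} \<longrightarrow> \<Sum>\<^sub># T \<noteq> 0)"

definition minimal_zero_sum_seqs :: "nat \<Rightarrow> 'a::ab_group_add set \<Rightarrow> 'a multiset set" where
  "minimal_zero_sum_seqs k X =
     {S. set_mset S \<subseteq> X \<and> minimal_zero_sum S \<and> card (set_mset S) = k}"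

text \<open>
  The maximal length is taken in \<^typ>\<open>enat\<close>, so that it is \<open>\<infinity>\<close> when the lengths are unbounded;
  a finite non-zero value is always attained.
\<close>

definition davenport_supp :: "nat \<Rightarrow> 'a::ab_group_add set \<Rightarrow> enat" where
  "davenport_supp k X = (SUP S \<in> minimal_zero_sum_seqs k X. enat (size S))"

definition int_square :: "nat \<Rightarrow> (int \<times> int) set" where
  "int_square m = {- int m..int m} \<times> {- int m..int m}"

definition least_prime_nondivisor :: "nat \<Rightarrow> nat" where
  "least_prime_nondivisor m = (LEAST p. prime p \<and> \<not> p dvd m)"

text \<open>
  Both generators are involutions, so closing under composition with them yields the generated group.
\<close>

inductive_set square_symmetries :: "(int \<times> int \<Rightarrow> int \<times> int) set" where
  ident: "id \<in> square_symmetries"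
| reflect: "\<sigma> \<in> square_symmetries \<Longrightarrow> (\<lambda>(x, y). (- x, y)) \<circ> \<sigma> \<in> square_symmetries"
| swap: "\<sigma> \<in> square_symmetries \<Longrightarrow> (\<lambda>(x, y). (y, x)) \<circ> \<sigma> \<in> square_symmetries"

text \<open>
  For \<open>m \<ge> 2\<close>, a prime factor of \<open>m + 1\<close> does not divide \<open>m\<close>, so
  \<open>least_prime_nondivisor m \<le> m + 1 < 2 * m\<close>.
  Hence the subtraction on \<^typ>\<open>nat\<close> in the multiplicities below (and in
  \<open>4 * m\<^sup>2 - least_prime_nondivisor m\<close>) does not truncate.
\<close>

definition extremal_seq :: "nat \<Rightarrow> (int \<times> int) multiset" where
  "extremal_seq m =
     (let q = least_prime_nondivisor m in
        replicate_mset (q * (m - 1) + m) (int m, int m)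
      + replicate_mset (2 * m\<^sup>2 - m * q) (- int m, int m - 1)
      + replicate_mset (2 * m\<^sup>2 - m) (int m - int q, - int m))"

end

theory Submission
  imports Defs
begin

text \<open>
  If three spanning vectors \<open>u, v, w\<close> carry a minimal zero-sum sequence, its multiplicities are
  coprime, so by Cramer's rule \<open>det(v, w)\<close>, \<open>det(w, u)\<close>, \<open>det(u, v)\<close> are \<open>t\<close> times the multiplicities
  for one integer \<open>t\<close>, and \<open>\<bar>t\<bar>\<close> times the length is twice the area of the triangle \<open>uvw\<close>, at most
  \<open>4m\<^sup>2\<close>. A length above \<open>4m\<^sup>2 - 2m\<close> forces \<open>t = \<plusminus>1\<close> and a triangle that touches all four sides of the
  square, hence has a vertex in a corner. Up to symmetry its vertices are \<open>(m, m)\<close>, \<open>(-m, m - b)\<close>,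
  \<open>(m - c, -m)\<close>, and the length is \<open>4m\<^sup>2 - bc\<close>. Coprimality of the multiplicities makes \<open>bc\<close> coprime
  to \<open>m\<close> and excludes \<open>bc = 1\<close>, where \<open>2m - 1\<close> divides all of them; so \<open>bc \<ge> q(m)\<close>, with equality
  only for \<open>{b, c} = {1, q(m)}\<close>. Collinear supports give a length of at most \<open>4m\<close>.
\<close>

section \<open>Sequences over three points, and determinants\<close>

text \<open>Multiplicities may be 0, so subsequences have the same form.\<close>

definition seq3 :: "'a \<Rightarrow> nat \<Rightarrow> 'a \<Rightarrow> nat \<Rightarrow> 'a \<Rightarrow> nat \<Rightarrow> 'a multiset" where
  "seq3 u a v b w c = replicate_mset a u + replicate_mset b v + replicate_mset c w"

text \<open>The determinant of two plane vectors. For a triangle \<open>u\<close>, \<open>v\<close>,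
  \<open>w\<close>, the sum \<open>cross v w + cross w u + cross u v\<close> is twice its signed
  area.\<close>

definition cross :: "int \<times> int \<Rightarrow> int \<times> int \<Rightarrow> int" where
  "cross p q = fst p * snd q - snd p * fst q"

lemma size_seq3 [simp]: "size (seq3 u a v b w c) = a + b + c"
  by (simp add: seq3_def)

lemma set_mset_seq3:
  "a > 0 \<Longrightarrow> b > 0 \<Longrightarrow> c > 0 \<Longrightarrow> set_mset (seq3 u a v b w c) = {u, v, w}"
  by (auto simp: seq3_def)

lemma sum_mset_replicate_int_pair:
  "\<Sum>\<^sub># (replicate_mset n p) = (int n * fst p, int n * snd p)"
  by (induction n) (auto simp: algebra_simps plus_prod_def zero_prod_def)

lemma sum_mset_seq3_eq_0_iff:
  "\<Sum>\<^sub># (seq3 u a v b w c) = 0 \<longleftrightarrow>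
    int a * fst u + int b * fst v + int c * fst w = 0 \<and>
    int a * snd u + int b * snd v + int c * snd w = 0"
  by (simp add: seq3_def sum_mset_replicate_int_pair plus_prod_def zero_prod_def)

lemma multiset_eq_seq3_count:
  assumes "distinct [u, v, w]" "set_mset S \<subseteq> {u, v, w}"
  shows "S = seq3 u (count S u) v (count S v) w (count S w)"
proof (rule multiset_eqI)
  fix x
  show "count S x = count (seq3 u (count S u) v (count S v) w (count S w)) x"
  proof (cases "x \<in> {u, v, w}")
    case True
    then show ?thesis using assms(1) by (auto simp: seq3_def)
  next
    case False
    then have "x \<notin># S" using assms(2) by blast
    then show ?thesis using False by (auto simp: seq3_def not_in_iff)
  qed
qed

lemma count_seq3:
  assumes "distinct [u, v, w]"
  shows "count (seq3 u a v b w c) u = a" "count (seq3 u a v b w c) v = b"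
    "count (seq3 u a v b w c) w = c"
  using assms by (auto simp: seq3_def)

lemma seq3_subseteq_iff:
  assumes "distinct [u, v, w]"
  shows "seq3 u i v j w k \<subseteq># seq3 u a v b w c \<longleftrightarrow> i \<le> a \<and> j \<le> b \<and> k \<le> c"
proof
  assume "seq3 u i v j w k \<subseteq># seq3 u a v b w c"
  then have "count (seq3 u i v j w k) x \<le> count (seq3 u a v b w c) x" for x
    by (rule mset_subset_eq_count)
  from this[of u] this[of v] this[of w] show "i \<le> a \<and> j \<le> b \<and> k \<le> c"
    by (simp add: count_seq3[OF assms])
next
  assume "i \<le> a \<and> j \<le> b \<and> k \<le> c"
  then show "seq3 u i v j w k \<subseteq># seq3 u a v b w c"
    unfolding seq3_def by (intro subset_mset.add_mono) (auto simp: subseteq_mset_def)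
qed

lemma seq3_eq_iff:
  assumes "distinct [u, v, w]"
  shows "seq3 u i v j w k = seq3 u a v b w c \<longleftrightarrow> i = a \<and> j = b \<and> k = c"
  using count_seq3[OF assms] by metis

lemma seq3_eq_empty_iff: "seq3 u i v j w k = {#} \<longleftrightarrow> i = 0 \<and> j = 0 \<and> k = 0"
  by (simp add: seq3_def)

text \<open>Subsequences correspond to triples of smaller multiplicities, so minimality becomes a
  statement about the integer solutions of a linear system inside a box.\<close>

lemma minimal_zero_sum_seq3_iff:
  assumes "distinct [u, v, w]"
  shows "minimal_zero_sum (seq3 u a v b w c) \<longleftrightarrow>
    \<Sum>\<^sub># (seq3 u a v b w c) = 0 \<and>
    (\<forall>i j k. i \<le> a \<longrightarrow> j \<le> b \<longrightarrow> k \<le> c \<longrightarrow> \<Sum>\<^sub># (seq3 u i v j w k) = 0 \<longrightarrow>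
      (i = 0 \<and> j = 0 \<and> k = 0) \<or> (i = a \<and> j = b \<and> k = c))"
    (is "?L \<longleftrightarrow> ?Z \<and> ?R")
proof
  assume L: ?L
  have ?R
  proof (intro allI impI)
    fix i j k
    assume *: "i \<le> a" "j \<le> b" "k \<le> c" "\<Sum>\<^sub># (seq3 u i v j w k) = 0"
    have "seq3 u i v j w k \<subseteq># seq3 u a v b w c"
      using * by (simp add: seq3_subseteq_iff[OF assms])
    then have "seq3 u i v j w k = {#} \<or> seq3 u i v j w k = seq3 u a v b w c"
      using L * unfolding minimal_zero_sum_def by (metis subset_mset.le_less)
    then show "(i = 0 \<and> j = 0 \<and> k = 0) \<or> (i = a \<and> j = b \<and> k = c)"
      by (simp add: seq3_eq_iff[OF assms] seq3_eq_empty_iff)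
  qed
  then show "?Z \<and> ?R" using L by (simp add: minimal_zero_sum_def)
next
  assume R: "?Z \<and> ?R"
  show ?L unfolding minimal_zero_sum_def
  proof (intro conjI allI impI notI)
    show ?Z using R ..
    fix T
    assume T: "T \<subset># seq3 u a v b w c" "T \<noteq> {#}" "\<Sum>\<^sub># T = 0"
    have "set_mset T \<subseteq> set_mset (seq3 u a v b w c)"
      using T(1) by (meson set_mset_mono subset_mset.less_imp_le)
    also have "\<dots> \<subseteq> {u, v, w}" by (auto simp: seq3_def)
    finally obtain i j k where ijk: "T = seq3 u i v j w k"
      using multiset_eq_seq3_count[OF assms] by blast
    then have "i \<le> a" "j \<le> b" "k \<le> c"
      using T(1) seq3_subseteq_iff[OF assms] subset_mset.less_imp_le by metis+
    then have "(i = 0 \<and> j = 0 \<and> k = 0) \<or> (i = a \<and> j = b \<and> k = c)"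
      using R T(3) ijk by blast
    then show False using T ijk by (auto simp: seq3_eq_empty_iff)
  qed
qed

section \<open>A length bound in dimension one\<close>

lemma one_dim_bound_pos:
  fixes x y s m :: int and a b c :: nat
  assumes bds: "0 < x" "x \<le> m" "0 < y" "y \<le> m" "0 < s" "s \<le> m"
    and pos: "0 < a" "0 < b" "0 < c"
    and zero: "int a * x + int b * y = int c * s"
    and min: "\<And>i j k. i \<le> a \<Longrightarrow> j \<le> b \<Longrightarrow> k \<le> c \<Longrightarrow> int i * x + int j * y = int k * s \<Longrightarrow>
      (i = 0 \<and> j = 0 \<and> k = 0) \<or> (i = a \<and> j = b \<and> k = c)"
  shows "int (a + b + c) \<le> 4 * m"
proof -
  \<comment> \<open>otherwise \<open>s\<close> copies of \<open>x\<close> and \<open>x\<close> copies of \<open>-s\<close> form a proper zero-sum subsequence\<close>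
  have a: "int a < s"
  proof (rule ccontr)
    assume "\<not> int a < s"
    then have sa: "nat s \<le> a" and le: "s * x \<le> int a * x" using bds by simp_all
    have "0 \<le> int b * y" using bds by simp
    then have "s * x \<le> s * int c" using le zero by (simp add: mult.commute)
    then have "nat x \<le> c" using bds by simp
    then show False using min[of "nat s" 0 "nat x"] sa pos bds by (auto simp: mult.commute)
  qed
  have b: "int b < s"
  proof (rule ccontr)
    assume "\<not> int b < s"
    then have sb: "nat s \<le> b" and le: "s * y \<le> int b * y" using bds by simp_all
    have "0 \<le> int a * x" using bds by simp
    then have "s * y \<le> s * int c" using le zero by (simp add: mult.commute)
    then have "nat y \<le> c" using bds by simp
    then show False using min[of 0 "nat s" "nat y"] sb pos bds by (auto simp: mult.commute)
  qed
  \<comment> \<open>Inserted into the zero-sum equation, both estimates give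
    \<open>c < x + y\<close>. The length is then below \<open>2 * s + x + y\<close>, which is at
    most \<open>4 * m\<close>.\<close>
  have "int a * x < s * x" "int b * y < s * y" using a b bds by simp_all
  then have "s * int c < s * (x + y)" using zero by (simp add: algebra_simps)
  then have "int c < x + y" using bds by simp
  then show ?thesis using a b bds by simp
qed

text \<open>Negating all three numbers exchanges the two sign patterns; the absolute value of
  \<open>z\<close> takes the place of \<open>s\<close>.\<close>

lemma one_dim_bound_same_sign:
  fixes x y z m :: int and a b c :: nat
  assumes sgn: "0 < x \<and> 0 < y \<and> z < 0 \<or> x < 0 \<and> y < 0 \<and> 0 < z"
    and bds: "\<bar>x\<bar> \<le> m" "\<bar>y\<bar> \<le> m" "\<bar>z\<bar> \<le> m"
    and pos: "0 < a" "0 < b" "0 < c"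
    and zero: "int a * x + int b * y + int c * z = 0"
    and min: "\<And>i j k. i \<le> a \<Longrightarrow> j \<le> b \<Longrightarrow> k \<le> c \<Longrightarrow> int i * x + int j * y + int k * z = 0 \<Longrightarrow>
      (i = 0 \<and> j = 0 \<and> k = 0) \<or> (i = a \<and> j = b \<and> k = c)"
  shows "int (a + b + c) \<le> 4 * m"
  using sgn
proof
  assume s: "0 < x \<and> 0 < y \<and> z < 0"
  show ?thesis
  proof (rule one_dim_bound_pos[of x m y "-z" a b c])
    fix i j k
    assume "i \<le> a" "j \<le> b" "k \<le> c" "int i * x + int j * y = int k * (-z)"
    then show "(i = 0 \<and> j = 0 \<and> k = 0) \<or> (i = a \<and> j = b \<and> k = c)"
      using min[of i j k] by simp
  qed (use s bds pos zero in \<open>simp_all\<close>)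
next
  assume s: "x < 0 \<and> y < 0 \<and> 0 < z"
  show ?thesis
  proof (rule one_dim_bound_pos[of "-x" m "-y" z a b c])
    fix i j k
    assume "i \<le> a" "j \<le> b" "k \<le> c" "int i * (-x) + int j * (-y) = int k * z"
    then show "(i = 0 \<and> j = 0 \<and> k = 0) \<or> (i = a \<and> j = b \<and> k = c)"
      using min[of i j k] by simp
  qed (use s bds pos zero in \<open>simp_all\<close>)
qed

text \<open>A zero sum with positive multiplicities excludes three equal signs, so exactly two of
  the numbers share a sign. A permutation puts these two first.\<close>

lemma one_dim_bound:
  fixes x y z m :: int and a b c :: nat
  assumes nz: "x \<noteq> 0" "y \<noteq> 0" "z \<noteq> 0"
    and bds: "\<bar>x\<bar> \<le> m" "\<bar>y\<bar> \<le> m" "\<bar>z\<bar> \<le> m"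
    and pos: "0 < a" "0 < b" "0 < c"
    and zero: "int a * x + int b * y + int c * z = 0"
    and min: "\<And>i j k. i \<le> a \<Longrightarrow> j \<le> b \<Longrightarrow> k \<le> c \<Longrightarrow> int i * x + int j * y + int k * z = 0 \<Longrightarrow>
      (i = 0 \<and> j = 0 \<and> k = 0) \<or> (i = a \<and> j = b \<and> k = c)"
  shows "int (a + b + c) \<le> 4 * m"
proof -
  have "\<not> (0 < x \<and> 0 < y \<and> 0 < z)"
    using zero pos by (smt (verit) mult_pos_pos of_nat_0_less_iff)
  moreover have "\<not> (x < 0 \<and> y < 0 \<and> z < 0)"
    using zero pos by (smt (verit) mult_pos_neg of_nat_0_less_iff)
  ultimately consider "0 < x \<and> 0 < y \<and> z < 0 \<or> x < 0 \<and> y < 0 \<and> 0 < z"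
    | "0 < x \<and> 0 < z \<and> y < 0 \<or> x < 0 \<and> z < 0 \<and> 0 < y"
    | "0 < y \<and> 0 < z \<and> x < 0 \<or> y < 0 \<and> z < 0 \<and> 0 < x"
    using nz by (metis linorder_neq_iff)
  then show ?thesis
  proof cases
    case 1
    show ?thesis by (rule one_dim_bound_same_sign[OF 1 bds pos zero min])
  next
    case 2
    have "int (a + c + b) \<le> 4 * m"
    proof (rule one_dim_bound_same_sign[OF 2])
      fix i k j
      assume "i \<le> a" "k \<le> c" "j \<le> b" "int i * x + int k * z + int j * y = 0"
      then show "(i = 0 \<and> k = 0 \<and> j = 0) \<or> (i = a \<and> k = c \<and> j = b)"
        using min[of i j k] by auto
    qed (use bds pos zero in linarith)+
    then show ?thesis by simp
  next
    case 3
    have "int (b + c + a) \<le> 4 * m"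
    proof (rule one_dim_bound_same_sign[OF 3])
      fix j k i
      assume "j \<le> b" "k \<le> c" "i \<le> a" "int j * y + int k * z + int i * x = 0"
      then show "(j = 0 \<and> k = 0 \<and> i = 0) \<or> (j = b \<and> k = c \<and> i = a)"
        using min[of i j k] by auto
    qed (use bds pos zero in linarith)+
    then show ?thesis by simp
  qed
qed

section \<open>Cramer's rule and coprime multiplicities\<close>

text \<open>Bezout coefficients that combine \<open>a\<close>, \<open>b\<close>, \<open>c\<close> to
  1 combine \<open>x\<close>, \<open>y\<close>, \<open>z\<close> to the factor of proportionality,
  which is therefore an integer.\<close>

lemma proportional_imp_multiple:
  fixes a b c x y z :: int
  assumes "gcd a (gcd b c) = 1"
    and "x * b = y * a" "x * c = z * a" "y * c = z * b"
  obtains t where "x = t * a" "y = t * b" "z = t * c"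
proof -
  obtain p q where pq: "p * b + q * c = gcd b c" using bezout_int by blast
  obtain r s where rs: "r * a + s * gcd b c = 1" using bezout_int assms(1) by metis
  have one: "r * a + s * p * b + s * q * c = 1"
    using rs unfolding pq[symmetric] by (simp add: algebra_simps)
  define t where "t = r * x + s * p * y + s * q * z"
  have "t * a = x * (r * a + s * p * b + s * q * c)"
    unfolding t_def using assms(2-4) by algebra
  moreover have "t * b = y * (r * a + s * p * b + s * q * c)"
    unfolding t_def using assms(2-4) by algebra
  moreover have "t * c = z * (r * a + s * p * b + s * q * c)"
    unfolding t_def using assms(2-4) by algebra
  ultimately show ?thesis using that[of t] one by simp
qed

text \<open>Take the determinant of the zero sum with \<open>w\<close>, \<open>v\<close> and
  \<open>u\<close> in turn. This form of Cramer's rule needs no division and allows zero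
  multiplicities, so it also applies to subsequences.\<close>

lemma cross_proportional:
  assumes "\<Sum>\<^sub># (seq3 u a v b w c) = 0"
  shows "cross v w * int b = cross w u * int a"
    and "cross v w * int c = cross u v * int a"
    and "cross w u * int c = cross u v * int b"
proof -
  have 1: "int a * fst u + int b * fst v + int c * fst w = 0"
    and 2: "int a * snd u + int b * snd v + int c * snd w = 0"
    using assms by (simp_all add: sum_mset_seq3_eq_0_iff)
  show "cross v w * int b = cross w u * int a"
    unfolding cross_def using 1 2 by algebra
  show "cross v w * int c = cross u v * int a"
    unfolding cross_def using 1 2 by algebra
  show "cross w u * int c = cross u v * int b"
    unfolding cross_def using 1 2 by algebra
qed

text \<open>Dividing all multiplicities by their gcd leaves a non-empty zero-sum subsequence, which
  by minimality is the whole sequence.\<close>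

lemma minimal_zero_sum_gcd:
  fixes u v w :: "int \<times> int"
  assumes "distinct [u, v, w]" "minimal_zero_sum (seq3 u a v b w c)" "a > 0"
  shows "gcd (int a) (gcd (int b) (int c)) = 1"
proof -
  define g where "g = gcd a (gcd b c)"
  obtain i j k where ijk: "a = g * i" "b = g * j" "c = g * k"
    unfolding g_def by (metis dvd_def gcd_dvd1 gcd_dvd2 dvd_trans)
  have g: "g > 0" using assms(3) ijk by (cases g) auto
  have "\<Sum>\<^sub># (seq3 u a v b w c) = 0" using assms(2) by (simp add: minimal_zero_sum_def)
  then have "int g * (int i * fst u + int j * fst v + int k * fst w) = 0"
    "int g * (int i * snd u + int j * snd v + int k * snd w) = 0"
    unfolding sum_mset_seq3_eq_0_iff ijk by (simp_all add: algebra_simps)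
  then have "\<Sum>\<^sub># (seq3 u i v j w k) = 0"
    using g by (simp add: sum_mset_seq3_eq_0_iff)
  moreover have "i \<le> a" "j \<le> b" "k \<le> c" using g ijk by auto
  ultimately have "(i = 0 \<and> j = 0 \<and> k = 0) \<or> (i = a \<and> j = b \<and> k = c)"
    using assms(2) minimal_zero_sum_seq3_iff[OF assms(1)] by blast
  then have "i = a" using ijk assms(3) by auto
  then have "g = 1" using ijk(1) assms(3) by simp
  then show ?thesis by (simp add: g_def gcd_int_int_eq)
qed

section \<open>Doubled area of a triangle in a box\<close>

text \<open>With the vertices sorted by height, the doubled area splits at the middle vertex into
  \<open>(p2 - p1) * A + (p2 - p3) * B\<close>. The horizontal differences are at most the width of
  the box, and \<open>A + B\<close> is at most its height.\<close>

lemma doubled_area_le_box: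
  fixes x1 x2 x3 y1 y2 y3 l r bo to :: int
  assumes "{x1, x2, x3} \<subseteq> {l..r}" "{y1, y2, y3} \<subseteq> {bo..to}"
  shows "\<bar>x1 * (y2 - y3) + x2 * (y3 - y1) + x3 * (y1 - y2)\<bar> \<le> (r - l) * (to - bo)"
proof -
  have ord: "\<bar>p1 * (t2 - t3) + p2 * (t3 - t1) + p3 * (t1 - t2)\<bar> \<le> (r - l) * (to - bo)"
    if *: "{p1, p2, p3} \<subseteq> {l..r}" "{t1, t2, t3} \<subseteq> {bo..to}" "t1 \<le> t2" "t2 \<le> t3"
    for p1 p2 p3 t1 t2 t3 :: int
  proof -
    define A where "A = t3 - t2"
    define B where "B = t2 - t1"
    have AB: "A \<ge> 0" "B \<ge> 0" using * by (auto simp: A_def B_def)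
    have eq: "p1 * (t2 - t3) + p2 * (t3 - t1) + p3 * (t1 - t2) = (p2 - p1) * A + (p2 - p3) * B"
      unfolding A_def B_def by (simp add: algebra_simps)
    have "\<bar>(p2 - p1) * A + (p2 - p3) * B\<bar> \<le> \<bar>p2 - p1\<bar> * A + \<bar>p2 - p3\<bar> * B"
      using AB by (metis abs_mult abs_of_nonneg abs_triangle_ineq)
    also have "\<dots> \<le> (r - l) * A + (r - l) * B"
      using AB * by (intro add_mono mult_right_mono) auto
    also have "\<dots> = (r - l) * (t3 - t1)" unfolding A_def B_def by (simp add: algebra_simps)
    also have "\<dots> \<le> (r - l) * (to - bo)" using * by (intro mult_left_mono) auto
    finally show ?thesis using eq by simp
  qed
  \<comment> \<open>Permuting the vertices changes at most the sign of the expression, so each order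
    reduces to the sorted one.\<close>
  consider "y1 \<le> y2" "y2 \<le> y3" | "y1 \<le> y3" "y3 \<le> y2" | "y2 \<le> y1" "y1 \<le> y3"
    | "y2 \<le> y3" "y3 \<le> y1" | "y3 \<le> y1" "y1 \<le> y2" | "y3 \<le> y2" "y2 \<le> y1" by linarith
  then show ?thesis
  proof cases
    case 1 then show ?thesis using ord[of x1 x2 x3 y1 y2 y3] assms by simp
  next
    case 2 then show ?thesis using ord[of x1 x3 x2 y1 y3 y2] assms by (simp add: algebra_simps)
  next
    case 3 then show ?thesis using ord[of x2 x1 x3 y2 y1 y3] assms by (simp add: algebra_simps)
  next
    case 4 then show ?thesis using ord[of x2 x3 x1 y2 y3 y1] assms by (simp add: algebra_simps)
  next
    case 5 then show ?thesis using ord[of x3 x1 x2 y3 y1 y2] assms by (simp add: algebra_simps)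
  next
    case 6 then show ?thesis using ord[of x3 x2 x1 y3 y2 y1] assms by (simp add: algebra_simps)
  qed
qed

lemma cross_sum_abs_le:
  assumes "fst ` {u, v, w} \<subseteq> {l..r}" "snd ` {u, v, w} \<subseteq> {bo..to}"
  shows "\<bar>cross v w + cross w u + cross u v\<bar> \<le> (r - l) * (to - bo)"
  using doubled_area_le_box[of "fst u" "fst v" "fst w" l r "snd u" "snd v" "snd w" bo to] assms
  by (simp add: cross_def algebra_simps)

section \<open>Supports on a line through the origin\<close>

text \<open>All points lie on the line through the origin and \<open>u\<close>. As
  \<open>f u\<close> is nonzero, the coordinate \<open>f\<close> determines the other one on this
  line, so zero sums can be read off \<open>f\<close> and the one-dimensional bound applies. Leaving
  open which coordinate \<open>f\<close> is covers vertical and horizontal lines alike.\<close>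

lemma collinear_minimal_zero_sum_bound:
  fixes f g :: "int \<times> int \<Rightarrow> int"
  assumes fg: "f = fst \<and> g = snd \<or> f = snd \<and> g = fst"
    and dist: "distinct [u, v, w]" and min: "minimal_zero_sum (seq3 u a v b w c)"
    and pos: "a > 0" "b > 0" "c > 0"
    and zero: "cross u v = 0" "cross w u = 0"
    and nz: "f u \<noteq> 0" "v \<noteq> 0" "w \<noteq> 0"
    and bds: "\<bar>f u\<bar> \<le> m" "\<bar>f v\<bar> \<le> m" "\<bar>f w\<bar> \<le> m"
  shows "int (a + b + c) \<le> 4 * m"
proof -
  have c: "f u * g v = g u * f v" "f u * g w = g u * f w"
    using zero fg by (auto simp: cross_def algebra_simps)
  have nz0: "f p \<noteq> 0 \<or> g p \<noteq> 0" if "p \<noteq> 0" for p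
    using that fg by (auto simp: prod_eq_iff)
  have nv: "f v \<noteq> 0" "f w \<noteq> 0" using c nz nz0 by fastforce+
  have sum: "\<Sum>\<^sub># (seq3 u i v j w k) = 0 \<longleftrightarrow> int i * f u + int j * f v + int k * f w = 0" for i j k
  proof -
    have "f u * (int i * g u + int j * g v + int k * g w) =
        g u * (int i * f u + int j * f v + int k * f w)"
      using c by algebra
    then have "int i * f u + int j * f v + int k * f w = 0 \<Longrightarrow>
        int i * g u + int j * g v + int k * g w = 0"
      using nz(1) by simp
    then show ?thesis using fg unfolding sum_mset_seq3_eq_0_iff by blast
  qed
  show ?thesis
    using nz(1) nv bds pos
  proof (rule one_dim_bound)
    show "int a * f u + int b * f v + int c * f w = 0"
      using min sum by (simp add: minimal_zero_sum_def)
  next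
    fix i j k
    assume "i \<le> a" "j \<le> b" "k \<le> c" "int i * f u + int j * f v + int k * f w = 0"
    then show "(i = 0 \<and> j = 0 \<and> k = 0) \<or> (i = a \<and> j = b \<and> k = c)"
      using min sum minimal_zero_sum_seq3_iff[OF dist] by blast
  qed
qed

section \<open>Long sequences: the length is a doubled area\<close>

lemma minimal_zero_sum_seqs_3_seq3:
  assumes "S \<in> minimal_zero_sum_seqs 3 X" "set_mset S = {u, v, w}"
  obtains a b c where "distinct [u, v, w]" "a > 0" "b > 0" "c > 0" "S = seq3 u a v b w c"
    "minimal_zero_sum (seq3 u a v b w c)"
proof -
  have "card {u, v, w} = 3" using assms by (simp add: minimal_zero_sum_seqs_def)
  then have d: "distinct [u, v, w]"
    by (auto simp: card_insert_if split: if_splits)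
  have S: "S = seq3 u (count S u) v (count S v) w (count S w)"
    using multiset_eq_seq3_count[OF d] assms(2) by blast
  have "u \<in># S" "v \<in># S" "w \<in># S" using assms(2) by auto
  then show ?thesis
    using that[OF d _ _ _ S] S assms(1) by (auto simp: minimal_zero_sum_seqs_def)
qed

text \<open>A zero term is a zero-sum subsequence by itself, and it is proper unless it is the whole
  sequence.\<close>

lemma nonzero_of_minimal_zero_sum:
  assumes "minimal_zero_sum S" "p \<in># S" "S \<noteq> {#p#}"
  shows "p \<noteq> 0"
proof
  assume "p = 0"
  have "{#p#} \<subset># S" using assms(2,3) by (simp add: subset_mset.less_le)
  then show False using assms(1) \<open>p = 0\<close> unfolding minimal_zero_sum_def by fastforce
qed

text \<open>The case \<open>t = 0\<close> is collinear and gives length at most \<open>4m\<close>.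
  If \<open>\<bar>t\<bar> \<ge> 2\<close>, twice the length is at most the doubled area, so the
  length is at most \<open>2m\<^sup>2\<close>. Neither exceeds
  \<open>4m\<^sup>2 - 2m\<close>.\<close>

lemma large_minimal_zero_sum_cross:
  fixes m :: nat
  assumes m: "m \<ge> 2"
    and S: "distinct [u, v, w]" "minimal_zero_sum (seq3 u a v b w c)" "a > 0" "b > 0" "c > 0"
    and sq: "{u, v, w} \<subseteq> int_square m"
    and large: "int (a + b + c) > 4 * (int m)\<^sup>2 - 2 * int m"
  obtains t where "t = 1 \<or> t = -1" "cross v w = t * int a" "cross w u = t * int b"
    "cross u v = t * int c"
proof -
  have z: "\<Sum>\<^sub># (seq3 u a v b w c) = 0" using S(2) by (simp add: minimal_zero_sum_def)
  obtain t where t: "cross v w = t * int a" "cross w u = t * int b" "cross u v = t * int c"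
    using proportional_imp_multiple[OF minimal_zero_sum_gcd[OF S(1-3)] cross_proportional[OF z]] .
  have bds: "\<bar>fst p\<bar> \<le> int m \<and> \<bar>snd p\<bar> \<le> int m" if "p \<in> {u, v, w}" for p
    using subsetD[OF sq that] by (auto simp: int_square_def)
  have mm: "2 * int m \<le> (int m)\<^sup>2" using m by (simp add: power2_eq_square)
  have "t \<noteq> 0"
  proof
    assume "t = 0"
    then have cz: "cross u v = 0" "cross w u = 0" using t by auto
    have "p \<noteq> 0" if "p \<in> {u, v, w}" for p
    proof (rule nonzero_of_minimal_zero_sum[OF S(2)])
      show "p \<in># seq3 u a v b w c" using that S by (simp add: set_mset_seq3)
      have "size (seq3 u a v b w c) > 1" using S by simp
      then show "seq3 u a v b w c \<noteq> {#p#}" by (metis less_irrefl size_single)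
    qed
    then have nz: "u \<noteq> 0" "v \<noteq> 0" "w \<noteq> 0" by auto
    from nz(1) have "fst u \<noteq> 0 \<or> snd u \<noteq> 0" by (auto simp: prod_eq_iff)
    then have "int (a + b + c) \<le> 4 * int m"
    proof
      assume "fst u \<noteq> 0"
      from collinear_minimal_zero_sum_bound[of fst snd, OF _ S cz this nz(2,3), of "int m"] bds
      show ?thesis by simp
    next
      assume "snd u \<noteq> 0"
      from collinear_minimal_zero_sum_bound[of snd fst, OF _ S cz this nz(2,3), of "int m"] bds
      show ?thesis by simp
    qed
    then show False using large mm m by linarith
  qed
  moreover have "\<bar>t\<bar> < 2"
  proof (rule ccontr)
    assume "\<not> \<bar>t\<bar> < 2"
    then have "2 * int (a + b + c) \<le> \<bar>t\<bar> * int (a + b + c)" by (intro mult_right_mono) auto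
    also have "\<dots> = \<bar>cross v w + cross w u + cross u v\<bar>"
      unfolding t by (simp add: abs_mult flip: distrib_left)
    also have "\<dots> \<le> (int m - - int m) * (int m - - int m)"
      using bds by (intro cross_sum_abs_le image_subsetI) (simp_all add: abs_le_iff minus_le_iff)
    also have "\<dots> = 4 * (int m)\<^sup>2" by (simp add: power2_eq_square)
    finally have "2 * int (a + b + c) \<le> 4 * (int m)\<^sup>2" .
    moreover have "2 * (int m)\<^sup>2 < int (a + b + c)" using large mm by linarith
    moreover have False if "2 * x \<le> 4 * y" "2 * y < x" for x y :: int using that by linarith
    ultimately show False by blast
  qed
  ultimately have "t = 1 \<or> t = -1" by auto
  then show ?thesis using that t by blast
qed

text \<open>For \<open>t = 1\<close> or \<open>t = -1\<close> the three determinants have a common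
  sign and the multiplicities as absolute values. Area estimates thus become length
  estimates.\<close>

lemma large_minimal_zero_sum_area:
  fixes m :: nat
  assumes m: "m \<ge> 2"
    and S: "S \<in> minimal_zero_sum_seqs 3 (int_square m)" "set_mset S = {u, v, w}"
    and large: "int (size S) > 4 * (int m)\<^sup>2 - 2 * int m"
  shows "\<bar>cross v w + cross w u + cross u v\<bar> = int (size S)"
proof -
  obtain a b c where *: "distinct [u, v, w]" "a > 0" "b > 0" "c > 0" "S = seq3 u a v b w c"
    "minimal_zero_sum (seq3 u a v b w c)"
    using minimal_zero_sum_seqs_3_seq3[OF S] .
  have sq: "{u, v, w} \<subseteq> int_square m" using S by (simp add: minimal_zero_sum_seqs_def)
  obtain t where "t = 1 \<or> t = -1" "cross v w = t * int a" "cross w u = t * int b"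
    "cross u v = t * int c"
    using large_minimal_zero_sum_cross[OF m *(1,6,2,3,4) sq] large *(5) by auto
  then show ?thesis using *(5) by auto
qed

text \<open>A triangle that misses a side of the square fits into a box with sides \<open>2m\<close>
  and \<open>2m - 1\<close>, so its doubled area is at most \<open>4m\<^sup>2 - 2m\<close>. This is
  the origin of the threshold.\<close>

lemma large_minimal_zero_sum_touches_sides:
  fixes m :: nat
  assumes m: "m \<ge> 2"
    and S: "S \<in> minimal_zero_sum_seqs 3 (int_square m)"
    and large: "int (size S) > 4 * (int m)\<^sup>2 - 2 * int m"
  shows "\<exists>p\<in>#S. fst p = int m" "\<exists>p\<in>#S. fst p = - int m"
    "\<exists>p\<in>#S. snd p = int m" "\<exists>p\<in>#S. snd p = - int m"
proof -
  have "card (set_mset S) = 3" using S by (simp add: minimal_zero_sum_seqs_def)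
  then obtain u v w where K: "set_mset S = {u, v, w}" by (metis card_3_iff)
  have sq: "{u, v, w} \<subseteq> int_square m" using S K by (simp add: minimal_zero_sum_seqs_def)
  have area: "\<bar>cross v w + cross w u + cross u v\<bar> > 4 * (int m)\<^sup>2 - 2 * int m"
    using large_minimal_zero_sum_area[OF m S K large] large by simp
  have box: "(r - l) * (to - bo) > 4 * (int m)\<^sup>2 - 2 * int m"
    if "\<And>p. p \<in># S \<Longrightarrow> l \<le> fst p \<and> fst p \<le> r \<and> bo \<le> snd p \<and> snd p \<le> to"
    for l r bo to
  proof -
    have "\<bar>cross v w + cross w u + cross u v\<bar> \<le> (r - l) * (to - bo)"
      using that unfolding K by (intro cross_sum_abs_le image_subsetI) simp_all
    then show ?thesis using area by linarith
  qed
  have bds: "- int m \<le> fst p" "fst p \<le> int m" "- int m \<le> snd p" "snd p \<le> int m"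
    if "p \<in># S" for p
    using subsetD[OF sq, of p] that by (auto simp: int_square_def K)
  have eq: "(2 * int m) * (2 * int m - 1) = 4 * (int m)\<^sup>2 - 2 * int m"
    by (simp add: power2_eq_square algebra_simps)
  show "\<exists>p\<in>#S. fst p = int m"
  proof (rule ccontr)
    assume no: "\<not> ?thesis"
    have "(int m - 1 - (- int m)) * (int m - (- int m)) > 4 * (int m)\<^sup>2 - 2 * int m"
    proof (rule box)
      fix p
      assume p: "p \<in># S"
      then have "fst p \<noteq> int m" using no by blast
      then show "- int m \<le> fst p \<and> fst p \<le> int m - 1 \<and> - int m \<le> snd p \<and> snd p \<le> int m"
        using bds[OF p] by linarith
    qed
    then show False using eq by (simp add: algebra_simps)
  qed
  show "\<exists>p\<in>#S. fst p = - int m"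
  proof (rule ccontr)
    assume no: "\<not> ?thesis"
    have "(int m - (- int m + 1)) * (int m - (- int m)) > 4 * (int m)\<^sup>2 - 2 * int m"
    proof (rule box)
      fix p
      assume p: "p \<in># S"
      then have "fst p \<noteq> - int m" using no by blast
      then show "- int m + 1 \<le> fst p \<and> fst p \<le> int m \<and> - int m \<le> snd p \<and> snd p \<le> int m"
        using bds[OF p] by linarith
    qed
    then show False using eq by (simp add: algebra_simps)
  qed
  show "\<exists>p\<in>#S. snd p = int m"
  proof (rule ccontr)
    assume no: "\<not> ?thesis"
    have "(int m - (- int m)) * (int m - 1 - (- int m)) > 4 * (int m)\<^sup>2 - 2 * int m"
    proof (rule box)
      fix p
      assume p: "p \<in># S"
      then have "snd p \<noteq> int m" using no by blast
      then show "- int m \<le> fst p \<and> fst p \<le> int m \<and> - int m \<le> snd p \<and> snd p \<le> int m - 1"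
        using bds[OF p] by linarith
    qed
    then show False using eq by (simp add: algebra_simps)
  qed
  show "\<exists>p\<in>#S. snd p = - int m"
  proof (rule ccontr)
    assume no: "\<not> ?thesis"
    have "(int m - (- int m)) * (int m - (- int m + 1)) > 4 * (int m)\<^sup>2 - 2 * int m"
    proof (rule box)
      fix p
      assume p: "p \<in># S"
      then have "snd p \<noteq> - int m" using no by blast
      then show "- int m \<le> fst p \<and> fst p \<le> int m \<and> - int m + 1 \<le> snd p \<and> snd p \<le> int m"
        using bds[OF p] by linarith
    qed
    then show False using eq by (simp add: algebra_simps)
  qed
qed

section \<open>Symmetries of the square\<close>

text \<open>The inductive definition only composes with generators on the left; induction on the
  left factor extends this to arbitrary products.\<close>

lemma square_symmetries_comp:
  assumes "\<sigma> \<in> square_symmetries" "\<tau> \<in> square_symmetries"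
  shows "\<sigma> \<circ> \<tau> \<in> square_symmetries"
  using assms(1)
proof induction
  case ident
  then show ?case by (simp add: assms(2))
next
  case (reflect \<sigma>)
  show ?case unfolding comp_assoc by (rule square_symmetries.reflect) fact
next
  case (swap \<sigma>)
  show ?case unfolding comp_assoc by (rule square_symmetries.swap) fact
qed

lemma reflect_in_square_symmetries: "(\<lambda>(x, y). (- x, y)) \<in> square_symmetries"
  using square_symmetries.reflect[OF square_symmetries.ident] by simp

lemma swap_in_square_symmetries: "(\<lambda>(x, y). (y, x)) \<in> square_symmetries"
  using square_symmetries.swap[OF square_symmetries.ident] by simp

text \<open>Each generator is its own inverse, so a generator prepended to \<open>\<sigma>\<close>
  is cancelled by appending it on the right of \<open>\<tau>\<close>.\<close>

lemma square_symmetries_inverse: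
  assumes "\<sigma> \<in> square_symmetries"
  obtains \<tau> where "\<tau> \<in> square_symmetries" "\<tau> \<circ> \<sigma> = id"
proof -
  have "\<exists>\<tau>\<in>square_symmetries. \<tau> \<circ> \<sigma> = id" using assms
  proof induction
    case ident
    show ?case by (intro bexI[of _ id]) (simp_all add: square_symmetries.ident)
  next
    case (reflect \<sigma>)
    then obtain \<tau> where \<tau>: "\<tau> \<in> square_symmetries" "\<tau> \<circ> \<sigma> = id" by blast
    have "(\<tau> \<circ> (\<lambda>(x, y). (- x, y))) \<circ> ((\<lambda>(x, y). (- x, y)) \<circ> \<sigma>) = \<tau> \<circ> \<sigma>"
      by (auto simp: fun_eq_iff split: prod.splits)
    then show ?case
      using \<tau> square_symmetries_comp reflect_in_square_symmetries by metis
  next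
    case (swap \<sigma>)
    then obtain \<tau> where \<tau>: "\<tau> \<in> square_symmetries" "\<tau> \<circ> \<sigma> = id" by blast
    have "(\<tau> \<circ> (\<lambda>(x, y). (y, x))) \<circ> ((\<lambda>(x, y). (y, x)) \<circ> \<sigma>) = \<tau> \<circ> \<sigma>"
      by (auto simp: fun_eq_iff split: prod.splits)
    then show ?case
      using \<tau> square_symmetries_comp swap_in_square_symmetries by metis
  qed
  then show ?thesis using that by blast
qed

lemma square_symmetries_add:
  assumes "\<sigma> \<in> square_symmetries"
  shows "\<sigma> (p + q) = \<sigma> p + \<sigma> q"
  using assms
  by (induction arbitrary: p q) (auto simp: plus_prod_def split: prod.splits)

lemma square_symmetries_zero:
  assumes "\<sigma> \<in> square_symmetries"
  shows "\<sigma> 0 = 0"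
  using square_symmetries_add[OF assms, of 0 0] by simp

lemma square_symmetries_int_square:
  assumes "\<sigma> \<in> square_symmetries" "p \<in> int_square m"
  shows "\<sigma> p \<in> int_square m"
  using assms
proof (induction arbitrary: p)
  case ident
  then show ?case by simp
next
  case (reflect \<sigma>)
  then have "\<sigma> p \<in> int_square m" by blast
  then show ?case by (cases "\<sigma> p") (auto simp: int_square_def)
next
  case (swap \<sigma>)
  then have "\<sigma> p \<in> int_square m" by blast
  then show ?case by (cases "\<sigma> p") (auto simp: int_square_def)
qed

lemma sum_mset_image_square_symmetry:
  assumes "\<sigma> \<in> square_symmetries"
  shows "\<Sum>\<^sub># (image_mset \<sigma> S) = \<sigma> (\<Sum>\<^sub># S)"
  by (induction S) (simp_all add: square_symmetries_add[OF assms] square_symmetries_zero[OF assms])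

text \<open>A zero-sum subsequence of the image is pulled back along the inverse symmetry, which is
  additive as well.\<close>

lemma minimal_zero_sum_seqs_image_square_symmetry:
  assumes \<sigma>: "\<sigma> \<in> square_symmetries" and S: "S \<in> minimal_zero_sum_seqs k (int_square m)"
  shows "image_mset \<sigma> S \<in> minimal_zero_sum_seqs k (int_square m)"
proof -
  obtain \<tau> where \<tau>: "\<tau> \<in> square_symmetries" "\<tau> \<circ> \<sigma> = id"
    using square_symmetries_inverse[OF \<sigma>] .
  have inj: "inj \<sigma>" using \<tau>(2) by (metis inj_on_id inj_on_imageI2)
  have min: "minimal_zero_sum S" using S by (simp add: minimal_zero_sum_seqs_def)
  have "minimal_zero_sum (image_mset \<sigma> S)"
    unfolding minimal_zero_sum_def
  proof (intro conjI allI impI notI)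
    show "\<Sum>\<^sub># (image_mset \<sigma> S) = 0"
      using min by (simp add: sum_mset_image_square_symmetry[OF \<sigma>] square_symmetries_zero[OF \<sigma>]
          minimal_zero_sum_def)
    fix T
    assume T: "T \<subset># image_mset \<sigma> S" "T \<noteq> {#}" "\<Sum>\<^sub># T = 0"
    have "image_mset \<tau> T \<subset># image_mset \<tau> (image_mset \<sigma> S)"
      using T(1) by (rule image_mset_subset_mono)
    also have "image_mset \<tau> (image_mset \<sigma> S) = S"
      using \<tau>(2) by (simp add: multiset.map_comp)
    finally have "image_mset \<tau> T \<subset># S" .
    moreover have "\<Sum>\<^sub># (image_mset \<tau> T) = 0"
      using T(3) by (simp add: sum_mset_image_square_symmetry[OF \<tau>(1)] square_symmetries_zero[OF \<tau>(1)])
    ultimately show False using min T(2) unfolding minimal_zero_sum_def by auto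
  qed
  moreover have "card (\<sigma> ` set_mset S) = card (set_mset S)"
    using inj by (intro card_image) (auto intro: inj_on_subset)
  ultimately show ?thesis
    using S square_symmetries_int_square[OF \<sigma>] by (auto simp: minimal_zero_sum_seqs_def)
qed

section \<open>Normal form of long sequences\<close>

text \<open>Three points touch four sides, so some point lies on two of them. Opposite sides are
  disjoint, hence that point is a corner, and a symmetry moves it to \<open>(m, m)\<close>.\<close>

lemma large_minimal_zero_sum_corner:
  fixes m :: nat
  assumes m: "m \<ge> 2"
    and S: "S \<in> minimal_zero_sum_seqs 3 (int_square m)"
    and large: "int (size S) > 4 * (int m)\<^sup>2 - 2 * int m"
  obtains \<sigma> where "\<sigma> \<in> square_symmetries" "(int m, int m) \<in># image_mset \<sigma> S"
proof -
  obtain p1 p2 p3 p4 where p: "p1 \<in># S" "fst p1 = int m" "p2 \<in># S" "fst p2 = - int m"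
    "p3 \<in># S" "snd p3 = int m" "p4 \<in># S" "snd p4 = - int m"
    using large_minimal_zero_sum_touches_sides[OF m S large] by blast
  have "card {p1, p2, p3, p4} \<le> card (set_mset S)"
    using p by (intro card_mono) auto
  also have "\<dots> = 3" using S by (simp add: minimal_zero_sum_seqs_def)
  finally have "card (set [p1, p2, p3, p4]) < length [p1, p2, p3, p4]" by simp
  then have "\<not> distinct [p1, p2, p3, p4]" by (metis distinct_card less_irrefl)
  moreover have "p1 \<noteq> p2" "p3 \<noteq> p4" using p m by auto
  ultimately have eq: "p1 = p3 \<or> p1 = p4 \<or> p2 = p3 \<or> p2 = p4" by auto
  have image: "(int m, int m) \<in># image_mset \<sigma> S" if "\<sigma> p = (int m, int m)" "p \<in># S"
    for \<sigma> :: "int \<times> int \<Rightarrow> int \<times> int" and p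
    using that by (metis image_eqI set_image_mset)
  \<comment> \<open>\<open>neg2\<close> concerns the map \<open>(x, y) \<mapsto> (x, -y)\<close>,
    and \<open>neg12\<close> the map \<open>(x, y) \<mapsto> (-x, -y)\<close>, both written as words
    in the generators.\<close>
  have neg2: "(\<lambda>(x, y). (y, x)) \<circ> ((\<lambda>(x, y). (- x, y)) \<circ> (\<lambda>(x, y). (y, x))) \<in> square_symmetries"
    by (intro square_symmetries.intros swap_in_square_symmetries)
  have neg12: "(\<lambda>(x, y). (- x, y)) \<circ> ((\<lambda>(x, y). (y, x)) \<circ> ((\<lambda>(x, y). (- x, y)) \<circ> (\<lambda>(x, y). (y, x))))
      \<in> square_symmetries"
    by (intro square_symmetries.intros swap_in_square_symmetries)
  from eq show ?thesis
  proof (elim disjE)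
    assume "p1 = p3"
    then have "p1 = (int m, int m)" using p by (simp add: prod_eq_iff)
    then show ?thesis using that[OF square_symmetries.ident] p(1) by simp
  next
    assume "p1 = p4"
    then have "p1 = (int m, - int m)" using p by (simp add: prod_eq_iff)
    then show ?thesis by (intro that[OF neg2 image[OF _ p(1)]]) simp
  next
    assume "p2 = p3"
    then have "p2 = (- int m, int m)" using p by (simp add: prod_eq_iff)
    then show ?thesis by (intro that[OF reflect_in_square_symmetries image[OF _ p(3)]]) simp
  next
    assume "p2 = p4"
    then have "p2 = (- int m, - int m)" using p by (simp add: prod_eq_iff)
    then show ?thesis by (intro that[OF neg12 image[OF _ p(3)]]) simp
  qed
qed

text \<open>The corner \<open>(m, m)\<close> lies on neither the left nor the bottom side, so other
  points \<open>p\<close> and \<open>q\<close> touch these. If they differ, they complete the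
  support.\<close>

lemma large_minimal_zero_sum_normal_form:
  fixes m :: nat
  assumes m: "m \<ge> 2"
    and S: "S \<in> minimal_zero_sum_seqs 3 (int_square m)"
    and large: "int (size S) > 4 * (int m)\<^sup>2 - 2 * int m"
    and corner: "(int m, int m) \<in># S"
  obtains b c :: nat where "b \<le> 2 * m" "c \<le> 2 * m"
    "set_mset S = {(int m, int m), (- int m, int m - int b), (int m - int c, - int m)}"
proof -
  obtain p q where p: "p \<in># S" "fst p = - int m" and q: "q \<in># S" "snd q = - int m"
    using large_minimal_zero_sum_touches_sides[OF m S large] by blast
  have card: "card (set_mset S) = 3" using S by (simp add: minimal_zero_sum_seqs_def)
  have bds: "- int m \<le> fst z" "fst z \<le> int m" "- int m \<le> snd z" "snd z \<le> int m"
    if "z \<in># S" for z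
    using S that by (auto simp: minimal_zero_sum_seqs_def int_square_def)
  show ?thesis
  proof (cases "p = q")
    case False
    have "p \<noteq> (int m, int m)" "q \<noteq> (int m, int m)" using p q m by auto
    then have "card {(int m, int m), p, q} = 3" using False by simp
    then have K: "set_mset S = {(int m, int m), p, q}"
      using p q corner card by (intro card_subset_eq[symmetric]) auto
    \<comment> \<open>The parameters are the distances of \<open>p\<close> from the corner
      \<open>(-m, m)\<close> and of \<open>q\<close> from the corner \<open>(m, -m)\<close>.\<close>
    show ?thesis
    proof (rule that[of "nat (int m - snd p)" "nat (int m - fst q)"])
      have "p = (- int m, snd p)" "q = (fst q, - int m)" using p q by (simp_all add: prod_eq_iff)
      then show "set_mset S = {(int m, int m), (- int m, int m - int (nat (int m - snd p))),
          (int m - int (nat (int m - fst q)), - int m)}"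
        unfolding K using bds[OF p(1)] bds[OF q(1)] by simp
    qed (use bds[OF p(1)] bds[OF q(1)] in linarith)+
  next
    \<comment> \<open>Now \<open>p\<close> is the corner opposite to \<open>(m, m)\<close>. With a
      third point \<open>z\<close> the doubled area is
      \<open>2m * \<bar>fst z - snd z\<bar>\<close>, which exceeds \<open>2m * (2m - 1)\<close> only
      if \<open>z\<close> is one of the two remaining corners. These are the degenerate parameters 0
      and \<open>2m\<close>.\<close>
    case True
    then have pp: "p = (- int m, - int m)" using p q by (simp add: prod_eq_iff)
    have "card (set_mset S - {(int m, int m), (- int m, - int m)}) = 1"
      using card corner p(1) m unfolding pp by (subst card_Diff_subset) auto
    then obtain z where z: "set_mset S - {(int m, int m), (- int m, - int m)} = {z}"
      by (auto simp: card_1_singleton_iff)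
    then have K: "set_mset S = {(int m, int m), (- int m, - int m), z}"
      using corner p(1) unfolding pp by blast
    have "int (size S) = \<bar>(2 * int m) * (fst z - snd z)\<bar>"
      using large_minimal_zero_sum_area[OF m S K large] by (simp add: cross_def algebra_simps)
    also have "\<dots> = (2 * int m) * \<bar>fst z - snd z\<bar>" by (simp add: abs_mult)
    finally have size: "int (size S) = (2 * int m) * \<bar>fst z - snd z\<bar>" .
    have "(2 * int m) * (2 * int m - 1) = 4 * (int m)\<^sup>2 - 2 * int m"
      by (simp add: power2_eq_square algebra_simps)
    then have "(2 * int m) * (2 * int m - 1) < (2 * int m) * \<bar>fst z - snd z\<bar>"
      using large size by linarith
    then have "2 * int m - 1 < \<bar>fst z - snd z\<bar>"
      using m by (subst (asm) mult_less_cancel_left_pos) auto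
    then have "z = (int m, - int m) \<or> z = (- int m, int m)"
      using bds[of z] K unfolding prod_eq_iff fst_conv snd_conv by fastforce
    then show ?thesis
    proof
      assume "z = (int m, - int m)"
      then show ?thesis using K by (intro that[of "2 * m" 0]) auto
    next
      assume "z = (- int m, int m)"
      then show ?thesis using K by (intro that[of 0 "2 * m"]) auto
    qed
  qed
qed

section \<open>The least prime nondivisor and the extremal multiplicities\<close>

lemma least_prime_nondivisor:
  assumes "m \<ge> 1"
  shows "prime (least_prime_nondivisor m)" "\<not> least_prime_nondivisor m dvd m"
    "least_prime_nondivisor m \<le> m + 1"
    "\<And>p. prime p \<Longrightarrow> p < least_prime_nondivisor m \<Longrightarrow> p dvd m"
proof -
  \<comment> \<open>This prime is coprime to \<open>m\<close>; it shows that the minimum exists and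
    bounds it.\<close>
  obtain p where p: "prime p" "p dvd m + 1"
    using prime_factor_nat[of "m + 1"] assms by auto
  have np: "\<not> p dvd m"
    using p by (metis dvd_add_right_iff not_prime_unit)
  have "prime (least_prime_nondivisor m) \<and> \<not> least_prime_nondivisor m dvd m"
    unfolding least_prime_nondivisor_def by (rule LeastI[of _ p]) (use p np in simp)
  then show "prime (least_prime_nondivisor m)" "\<not> least_prime_nondivisor m dvd m" by auto
  have "least_prime_nondivisor m \<le> p"
    unfolding least_prime_nondivisor_def by (rule Least_le) (use p np in simp)
  also have "p \<le> m + 1" using p(2) by (rule dvd_imp_le) simp
  finally show "least_prime_nondivisor m \<le> m + 1" .
  show "r dvd m" if "prime r" "r < least_prime_nondivisor m" for r
    using not_less_Least[of r "\<lambda>p. prime p \<and> \<not> p dvd m"] that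
    unfolding least_prime_nondivisor_def by blast
qed

lemma extremal_seq_seq3:
  "extremal_seq m = seq3
    (int m, int m) (least_prime_nondivisor m * (m - 1) + m)
    (- int m, int m - 1) (2 * m\<^sup>2 - m * least_prime_nondivisor m)
    (int m - int (least_prime_nondivisor m), - int m) (2 * m\<^sup>2 - m)"
  by (simp add: extremal_seq_def seq3_def Let_def)

text \<open>The right-hand sides are the determinants of the normal form for \<open>b = 1\<close>,
  \<open>c = q\<close>. The bound \<open>q \<le> 2m\<close> keeps the natural subtraction from
  truncating.\<close>

lemma extremal_multiplicities:
  fixes m :: nat
  assumes "m \<ge> 2"
  defines "q \<equiv> least_prime_nondivisor m"
  shows "int (q * (m - 1) + m) = int m * (1 + int q) - int q"
    and "int (2 * m\<^sup>2 - m * q) = int m * (2 * int m - int q)"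
    and "int (2 * m\<^sup>2 - m) = int m * (2 * int m - 1)"
proof -
  have q: "q \<le> 2 * m" using least_prime_nondivisor(3)[of m] assms by simp
  show "int (q * (m - 1) + m) = int m * (1 + int q) - int q"
    using assms(1) by (cases m) (simp_all add: algebra_simps)
  have "m * q \<le> m * (2 * m)" using q by (intro mult_left_mono) auto
  then have "m * q \<le> 2 * m\<^sup>2" by (simp add: power2_eq_square)
  then show "int (2 * m\<^sup>2 - m * q) = int m * (2 * int m - int q)"
    by (simp add: of_nat_diff power2_eq_square algebra_simps)
  have "m * 1 \<le> 2 * m\<^sup>2" by (simp add: power2_eq_square)
  then show "int (2 * m\<^sup>2 - m) = int m * (2 * int m - 1)"
    by (simp add: of_nat_diff power2_eq_square algebra_simps)
qed

section \<open>Uniqueness of the normal form\<close>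

lemma large_minimal_zero_sum_extremal:
  fixes m :: nat
  assumes m: "m \<ge> 2"
    and S: "S \<in> minimal_zero_sum_seqs 3 (int_square m)"
    and large: "int (size S) \<ge> 4 * (int m)\<^sup>2 - int (least_prime_nondivisor m)"
    and bc: "b \<le> 2 * m" "c \<le> 2 * m"
    and K: "set_mset S = {(int m, int m), (- int m, int m - int b), (int m - int c, - int m)}"
  shows "S = extremal_seq m \<or> S = image_mset (\<lambda>(x, y). (y, x)) (extremal_seq m)"
proof -
  define q where "q = least_prime_nondivisor m"
  have q: "prime q" "\<not> q dvd m" "q \<le> m + 1" "\<And>p. prime p \<Longrightarrow> p < q \<Longrightarrow> p dvd m"
    using least_prime_nondivisor[of m] m unfolding q_def by auto
  define A B C where "A = (int m, int m)" "B = (- int m, int m - int b)"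
    "C = (int m - int c, - int m)"
  note ABC = this
  obtain a1 a2 a3 where *: "distinct [A, B, C]" "a1 > 0" "a2 > 0" "a3 > 0" "S = seq3 A a1 B a2 C a3"
    "minimal_zero_sum (seq3 A a1 B a2 C a3)"
    using minimal_zero_sum_seqs_3_seq3[OF S, of A B C] K unfolding ABC by blast
  have "{A, B, C} \<subseteq> int_square m"
    using S K unfolding ABC by (simp add: minimal_zero_sum_seqs_def)
  \<comment> \<open>For \<open>m \<ge> 2\<close> one has \<open>q \<le> m + 1 < 2m\<close>, so the
    assumed length is above the threshold.\<close>
  moreover have "int (a1 + a2 + a3) > 4 * (int m)\<^sup>2 - 2 * int m"
    using large q(3) m *(5) unfolding q_def by simp
  ultimately obtain t where t: "t = 1 \<or> t = -1" "cross B C = t * int a1" "cross C A = t * int a2"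
    "cross A B = t * int a3"
    using large_minimal_zero_sum_cross[OF m *(1,6,2,3,4)] by blast
  have cr: "cross B C = int m * (int b + int c) - int b * int c"
    "cross C A = int m * (2 * int m - int c)" "cross A B = int m * (2 * int m - int b)"
    by (simp_all add: ABC cross_def algebra_simps)
  \<comment> \<open>The bound on \<open>c\<close> fixes the orientation of the triangle and thereby
    the sign of \<open>t\<close>.\<close>
  have "cross C A \<ge> 0" unfolding cr using bc by simp
  then have "t = 1" using t *(3) by auto
  then have a: "int a1 = int m * (int b + int c) - int b * int c"
    "int a2 = int m * (2 * int m - int c)" "int a3 = int m * (2 * int m - int b)"
    using t cr by simp_all
  \<comment> \<open>The three multiplicities add up to \<open>4m\<^sup>2 - bc\<close>.\<close>
  have "int (b * c) \<le> int q"
    using large a *(5) unfolding q_def by (simp add: power2_eq_square algebra_simps)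
  then have bcq: "b * c \<le> q" by linarith
  have dvd1: "d dvd 1" if "d dvd int a1" "d dvd int a2" "d dvd int a3" for d
    using minimal_zero_sum_gcd[OF *(1,6,2)] that by (metis gcd_greatest)
  have cop: "coprime (int m) (int b * int c)"
  proof (rule coprimeI)
    fix d assume "d dvd int m" "d dvd int b * int c"
    then show "is_unit d" unfolding a by (intro dvd1) (simp_all add: a)
  qed
  \<comment> \<open>Only units are coprime to 0, and \<open>m \<ge> 2\<close> is not one; this
    removes the degenerate triangles of the normal form.\<close>
  have "b * c \<noteq> 0"
  proof
    assume "b * c = 0"
    then have "int b * int c = 0" by (metis of_nat_0 of_nat_mult)
    then show False using cop m unfolding \<open>int b * int c = 0\<close> by simp
  qed
  moreover have "b * c \<noteq> 1"
  proof
    assume "b * c = 1"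
    then have "b = 1" "c = 1" by auto
    then have "int a1 = 2 * int m - 1" "int a2 = int m * (2 * int m - 1)"
      "int a3 = int m * (2 * int m - 1)" using a by simp_all
    then have "(2 * int m - 1) dvd 1" by (intro dvd1) simp_all
    then show False using m by (auto dest: zdvd_imp_le)
  qed
  ultimately obtain p where p: "prime p" "p dvd b * c" using prime_factor_nat by metis
  have "\<not> p dvd m"
  proof
    assume "p dvd m"
    then have "int p dvd int m" "int p dvd int b * int c" using p(2) by (simp_all flip: of_nat_mult)
    then have "is_unit (int p)" using cop by (meson coprime_common_divisor)
    then show False using p(1) by simp
  qed
  \<comment> \<open>The chain \<open>q \<le> p \<le> b * c \<le> q\<close> closes up, so
    \<open>b * c\<close> is the prime \<open>q\<close> and one factor is 1.\<close>
  then have "q \<le> p" using q(4)[OF p(1)] by (meson not_less)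
  moreover have "p \<le> b * c" using p(2) \<open>b * c \<noteq> 0\<close> by (intro dvd_imp_le) auto
  ultimately have eq: "b * c = q" using bcq by simp
  then have "b = 1 \<or> c = 1" using q(1) by (intro prime_product) simp
  then have "b = 1 \<and> c = q \<or> b = q \<and> c = 1" using eq by auto
  then show ?thesis
  proof (elim disjE conjE)
    assume h: "b = 1" "c = q"
    have "int a1 = int (q * (m - 1) + m)" "int a2 = int (2 * m\<^sup>2 - m * q)"
      "int a3 = int (2 * m\<^sup>2 - m)"
      unfolding a extremal_multiplicities[OF m, folded q_def] h by simp_all
    then have "a1 = q * (m - 1) + m" "a2 = 2 * m\<^sup>2 - m * q" "a3 = 2 * m\<^sup>2 - m"
      by (simp_all only: of_nat_eq_iff)
    then have "S = extremal_seq m"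
      unfolding *(5) ABC extremal_seq_seq3 h q_def[symmetric] by simp
    then show ?thesis ..
  next
    \<comment> \<open>This is the mirror image of the previous case in the diagonal, with the last
      two points exchanged.\<close>
    assume h: "b = q" "c = 1"
    have "int a1 = int (q * (m - 1) + m)" "int a2 = int (2 * m\<^sup>2 - m)"
      "int a3 = int (2 * m\<^sup>2 - m * q)"
      unfolding a extremal_multiplicities[OF m, folded q_def] h by (simp_all add: add.commute)
    then have "a1 = q * (m - 1) + m" "a2 = 2 * m\<^sup>2 - m" "a3 = 2 * m\<^sup>2 - m * q"
      by (simp_all only: of_nat_eq_iff)
    then have "S = image_mset (\<lambda>(x, y). (y, x)) (extremal_seq m)"
      unfolding *(5) ABC extremal_seq_seq3 h q_def[symmetric] by (simp add: seq3_def)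
    then show ?thesis ..
  qed
qed

section \<open>Minimality and length of the extremal sequence\<close>

text \<open>By Cramer's rule every zero-sum subsequence has multiplicities proportional to
  \<open>(n1, n2, n3)\<close>. As this triple is coprime, the factor is an integer, and it lies
  between 0 and 1.\<close>

lemma extremal_seq_minimal:
  fixes m :: nat
  assumes m: "m \<ge> 2"
  shows "extremal_seq m \<in> minimal_zero_sum_seqs 3 (int_square m)"
    and "size (extremal_seq m) = 4 * m\<^sup>2 - least_prime_nondivisor m"
proof -
  define q where "q = least_prime_nondivisor m"
  have q: "prime q" "\<not> q dvd m" "q \<le> m + 1" "\<And>p. prime p \<Longrightarrow> p < q \<Longrightarrow> p dvd m"
    using least_prime_nondivisor[of m] m unfolding q_def by auto
  have q2: "q \<ge> 2" using q(1) by (rule prime_ge_2_nat)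
  define A B C where "A = (int m, int m)" "B = (- int m, int m - 1)"
    "C = (int m - int q, - int m)"
  note ABC = this
  define n1 n2 n3 where "n1 = q * (m - 1) + m" "n2 = 2 * m\<^sup>2 - m * q" "n3 = 2 * m\<^sup>2 - m"
  note n_def = this
  have E: "extremal_seq m = seq3 A n1 B n2 C n3"
    by (simp add: extremal_seq_seq3 ABC n_def q_def)
  have n: "int n1 = int m * (1 + int q) - int q" "int n2 = int m * (2 * int m - int q)"
    "int n3 = int m * (2 * int m - 1)"
    using extremal_multiplicities[OF m] unfolding n_def q_def by simp_all
  have cr: "cross B C = int n1" "cross C A = int n2" "cross A B = int n3"
    by (simp_all add: ABC cross_def n algebra_simps)
  have dist: "distinct [A, B, C]" using m by (auto simp: ABC)
  have "int n2 > 0" "int n3 > 0" using q(3) m unfolding n by simp_all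
  moreover have "n1 > 0" using m by (simp add: n_def)
  ultimately have pos: "n1 > 0" "n2 > 0" "n3 > 0" by simp_all
  \<comment> \<open>Let a prime \<open>p\<close> divide all three. If \<open>p\<close> divides
    \<open>m\<close>, the first multiplicity yields \<open>p dvd q\<close>, so \<open>p = q\<close>,
    which does not divide \<open>m\<close>. Otherwise \<open>p\<close> divides both
    \<open>2m - 1\<close> and \<open>2m - q\<close>, hence \<open>q - 1\<close>; then
    \<open>p < q\<close>, and by the choice of \<open>q\<close> it divides \<open>m\<close> after
    all.\<close>
  have "gcd n1 (gcd n2 n3) = 1"
  proof (rule ccontr)
    assume "gcd n1 (gcd n2 n3) \<noteq> 1"
    then obtain p where p: "prime p" "p dvd gcd n1 (gcd n2 n3)" using prime_factor_nat by blast
    then have "p dvd n1" "p dvd n2" "p dvd n3" by simp_all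
    then have d: "int p dvd int m * (1 + int q) - int q" "int p dvd int m * (2 * int m - int q)"
      "int p dvd int m * (2 * int m - 1)" by (simp_all flip: n)
    have ip: "prime (int p)" using p(1) by simp
    show False
    proof (cases "p dvd m")
      case True
      then have "int p dvd int m * (1 + int q)" by simp
      then have "int p dvd int q" using d(1) by (metis dvd_diff_right_iff dvd_minus_iff)
      then have "p dvd q" by simp
      then have "p = q" using p(1) q(1) by (simp add: primes_dvd_imp_eq)
      then show False using True q(2) by simp
    next
      case False
      then have "int p dvd 2 * int m - int q" "int p dvd 2 * int m - 1"
        using d(2,3) ip by (simp_all add: prime_dvd_mult_iff)
      then have "int p dvd (2 * int m - 1) - (2 * int m - int q)" by (rule dvd_diff[rotated])
      then have "int p dvd int q - 1" by simp
      then have "int p \<le> int q - 1" using q2 by (intro zdvd_imp_le) auto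
      then show False using q(4)[OF p(1)] False by simp
    qed
  qed
  then have gcd: "gcd (int n1) (gcd (int n2) (int n3)) = 1" by (simp add: gcd_int_int_eq)
  have "minimal_zero_sum (seq3 A n1 B n2 C n3)"
    unfolding minimal_zero_sum_seq3_iff[OF dist]
  proof (intro conjI allI impI)
    show "\<Sum>\<^sub># (seq3 A n1 B n2 C n3) = 0"
      unfolding sum_mset_seq3_eq_0_iff n by (simp add: ABC algebra_simps)
    fix i j k
    assume ijk: "i \<le> n1" "j \<le> n2" "k \<le> n3" "\<Sum>\<^sub># (seq3 A i B j C k) = 0"
    from cross_proportional[OF ijk(4)]
    have "int i * int n2 = int j * int n1" "int i * int n3 = int k * int n1"
      "int j * int n3 = int k * int n2"
      unfolding cr by (simp_all add: mult.commute)
    from proportional_imp_multiple[OF gcd this]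
    obtain t where t: "int i = t * int n1" "int j = t * int n2" "int k = t * int n3" .
    have "0 \<le> t" using t(1) pos(1) by (metis of_nat_0_le_iff of_nat_0_less_iff zero_le_mult_iff not_less)
    moreover have "t * int n1 \<le> 1 * int n1" using t(1) ijk(1) by simp
    then have "t \<le> 1" using pos(1) by (subst (asm) mult_le_cancel_right_pos) auto
    ultimately have "t = 0 \<or> t = 1" by auto
    then show "(i = 0 \<and> j = 0 \<and> k = 0) \<or> (i = n1 \<and> j = n2 \<and> k = n3)"
      using t by auto
  qed
  moreover have "{A, B, C} \<subseteq> int_square m"
    using q(3) m by (auto simp: ABC int_square_def)
  moreover have "card {A, B, C} = 3" using dist by auto
  ultimately show "extremal_seq m \<in> minimal_zero_sum_seqs 3 (int_square m)"
    unfolding E minimal_zero_sum_seqs_def using pos by (simp add: set_mset_seq3)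
  have "int (n1 + n2 + n3) = 4 * (int m)\<^sup>2 - int q"
    by (simp add: n power2_eq_square algebra_simps)
  then have "n1 + n2 + n3 + q = 4 * m\<^sup>2"
    by (simp flip: of_nat_eq_iff[where 'a = int])
  then show "size (extremal_seq m) = 4 * m\<^sup>2 - least_prime_nondivisor m"
    unfolding E q_def[symmetric] by simp
qed

section \<open>Maximal length and uniqueness up to symmetry\<close>

theorem theorem3:
  fixes m :: nat
  assumes "m \<ge> 2"
  shows "davenport_supp 3 (int_square m) = enat (4 * m\<^sup>2 - least_prime_nondivisor m) \<and>
    (\<forall>S. S \<in> minimal_zero_sum_seqs 3 (int_square m) \<and> enat (size S) = davenport_supp 3 (int_square m) \<longleftrightarrow>
         (\<exists>\<sigma> \<in> square_symmetries. S = image_mset \<sigma> (extremal_seq m)))"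
proof -
  let ?X = "minimal_zero_sum_seqs 3 (int_square m)"
  define N where "N = 4 * m\<^sup>2 - least_prime_nondivisor m"
  \<comment> \<open>Assuming only \<open>size S \<ge> N\<close> lets this one claim serve for
    uniqueness and for the upper bound.\<close>
  have extremal: "\<exists>\<sigma>\<in>square_symmetries. S = image_mset \<sigma> (extremal_seq m)"
    if S: "S \<in> ?X" "size S \<ge> N" for S
  proof -
    have ge: "int (size S) \<ge> 4 * (int m)\<^sup>2 - int (least_prime_nondivisor m)"
      using S(2) unfolding N_def by (simp flip: of_nat_power of_nat_mult of_nat_add)
    then have large: "int (size S) > 4 * (int m)\<^sup>2 - 2 * int m"
      using least_prime_nondivisor(3)[of m] assms by simp
    obtain \<sigma> where \<sigma>: "\<sigma> \<in> square_symmetries" "(int m, int m) \<in># image_mset \<sigma> S"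
      using large_minimal_zero_sum_corner[OF assms S(1) large] .
    have S': "image_mset \<sigma> S \<in> ?X"
      by (rule minimal_zero_sum_seqs_image_square_symmetry[OF \<sigma>(1) S(1)])
    obtain b c where bc: "b \<le> 2 * m" "c \<le> 2 * m" "set_mset (image_mset \<sigma> S) =
        {(int m, int m), (- int m, int m - int b), (int m - int c, - int m)}"
      using large_minimal_zero_sum_normal_form[OF assms S' _ \<sigma>(2)] large by auto
    have "image_mset \<sigma> S = extremal_seq m \<or>
        image_mset \<sigma> S = image_mset (\<lambda>(x, y). (y, x)) (extremal_seq m)"
      using large_minimal_zero_sum_extremal[OF assms S' _ bc] ge by simp
    moreover have "extremal_seq m = image_mset id (extremal_seq m)" by simp
    ultimately obtain \<rho> where \<rho>: "\<rho> \<in> square_symmetries" "image_mset \<sigma> S = image_mset \<rho> (extremal_seq m)"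
      using square_symmetries.ident swap_in_square_symmetries by metis
    \<comment> \<open>The normalising symmetry is undone: \<open>S\<close> is the image of the
      extremal sequence under \<open>\<tau> \<circ> \<rho>\<close>.\<close>
    obtain \<tau> where \<tau>: "\<tau> \<in> square_symmetries" "\<tau> \<circ> \<sigma> = id"
      using square_symmetries_inverse[OF \<sigma>(1)] .
    have "S = image_mset (\<tau> \<circ> \<sigma>) S" by (simp add: \<tau>(2))
    also have "\<dots> = image_mset (\<tau> \<circ> \<rho>) (extremal_seq m)"
      by (simp flip: multiset.map_comp add: \<rho>(2))
    finally show ?thesis using square_symmetries_comp[OF \<tau>(1) \<rho>(1)] by blast
  qed
  have image: "image_mset \<sigma> (extremal_seq m) \<in> ?X \<and> size (image_mset \<sigma> (extremal_seq m)) = N"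
    if "\<sigma> \<in> square_symmetries" for \<sigma>
    using minimal_zero_sum_seqs_image_square_symmetry[OF that] extremal_seq_minimal[OF assms]
    by (simp add: N_def)
  \<comment> \<open>A sequence longer than \<open>N\<close> would be an image of the extremal
    sequence and so have length exactly \<open>N\<close>.\<close>
  have le: "size S \<le> N" if "S \<in> ?X" for S
    using extremal[OF that] image by (metis linear order_refl)
  have D: "davenport_supp 3 (int_square m) = enat N"
    unfolding davenport_supp_def
  proof (rule antisym)
    show "(SUP S\<in>?X. enat (size S)) \<le> enat N" using le by (intro SUP_least) simp
    have "enat (size (extremal_seq m)) \<le> (SUP S\<in>?X. enat (size S))"
      by (rule SUP_upper[OF extremal_seq_minimal(1)[OF assms]])
    then show "enat N \<le> (SUP S\<in>?X. enat (size S))"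
      using extremal_seq_minimal(2)[OF assms] by (simp add: N_def)
  qed
  show ?thesis
    unfolding D N_def[symmetric] using extremal image by auto
qed

end
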